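(* Let $q \geq 4$ be a prime power and $n = q^{2}-1$. Then there exists a convolutional code with parameters $(n,\; n-2q+1,\; 1;\; 1,\; d_{free} \geq q+2)_{q}$.
   Context: A matrix $G(D)=(g_{ij})\in \mathbb{F}_q[D]^{k\times n}$ is called basic if it has a polynomial right inverse. Its $i$-th row degree is $\gamma_i=\max_{1\le j\le n}\deg g_{ij}$ and its overall constraint length is $\gamma=\sum_{i=1}^k\gamma_i$. A basic generator matrix of a code is called reduced if its overall constraint length is the smallest among all basic generator matrices of that code. A convolutional code with parameters $(n,k,\gamma;\mu,d_f)_q$ is a submodule $C=\{\mathbf{u}(D)G(D) : \mathbf{u}(D)\in\mathbb{F}_q[D]^k\}$ of $\mathbb{F}_q[D]^n$ generated by a reduced basic matrix $G(D)\in\mathbb{F}_q[D]^{k\times n}$, where $n$ is the length, $k$ the dimension, $\gamma=\sum_{i=1}^k\gamma_i$ the degree, $\mu=\max_{1\le i\le k}\gamma_i$ the memory, and $d_f=d_{free}=\min\{\mathrm{wt}(\mathbf{v}(D)) : \mathbf{v}(D)\in C,\ \mathbf{v}(D)\neq 0\}$ the free distance; here $\mathrm{wt}(\mathbf{v}(D))$ is the total number of nonzero coefficients over all $n$ polynomial components of $\mathbf{v}(D)$. Writing "$d_{free}\ge a$" in the last slot means the free distance is at least $a$. *)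

theory Defs
  imports
    Jordan_Normal_Form.Matrix
    "HOL-Computational_Algebra.Polynomial"
    "HOL-Number_Theory.Prime_Powers"
begin

definition basic_matrix :: "'a :: field poly mat \<Rightarrow> bool" where
  "basic_matrix G \<longleftrightarrow>
     (\<exists>H \<in> carrier_mat (dim_col G) (dim_row G). G * H = 1\<^sub>m (dim_row G))"

text \<open>The library convention \<open>degree 0 = 0\<close> only affects the value on a zero row
  (where the usual convention gives minus infinity), and a basic matrix has no zero row.\<close>

definition row_degree :: "'a :: field poly mat \<Rightarrow> nat \<Rightarrow> nat" where
  "row_degree G i = Max ((\<lambda>j. degree (G $$ (i, j))) ` {..<dim_col G})"

definition constraint_length :: "'a :: field poly mat \<Rightarrow> nat" where
  "constraint_length G = (\<Sum>i<dim_row G. row_degree G i)"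

text \<open>The row vector \<open>u G\<close> is written as \<open>transpose_mat G *\<^sub>v u\<close>.\<close>

definition generated_code :: "'a :: field poly mat \<Rightarrow> 'a poly vec set" where
  "generated_code G = {transpose_mat G *\<^sub>v u | u. u \<in> carrier_vec (dim_row G)}"

text \<open>The competing basic matrices are not required to have as many rows as \<open>G\<close>: any two
  basic matrices generating the same code have the same number of rows, the rank of the code.\<close>

definition reduced_matrix :: "'a :: field poly mat \<Rightarrow> bool" where
  "reduced_matrix G \<longleftrightarrow> basic_matrix G \<and>
     (\<forall>G'. dim_col G' = dim_col G \<and> basic_matrix G' \<and> generated_code G' = generated_code G
        \<longrightarrow> constraint_length G \<le> constraint_length G')"

definition wt :: "'a :: field poly vec \<Rightarrow> nat" where
  "wt v = (\<Sum>j<dim_vec v. card {i. coeff (v $ j) i \<noteq> 0})"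

text \<open>The infimum in \<open>nat\<close> of a nonempty set is its minimum; for the zero code, where the free
  distance is undefined, it takes the value \<open>0\<close>.\<close>

definition free_distance :: "'a :: field poly vec set \<Rightarrow> nat" where
  "free_distance C = Inf {wt v | v. v \<in> C \<and> v \<noteq> 0\<^sub>v (dim_vec v)}"

text \<open>\<open>convolutional_code n k \<gamma> \<mu> d C\<close>: \<open>C\<close> has parameters \<open>(n, k, \<gamma>; \<mu>, d)\<close> over the field
  \<open>'a\<close>.\<close>

definition convolutional_code ::
    "nat \<Rightarrow> nat \<Rightarrow> nat \<Rightarrow> nat \<Rightarrow> nat \<Rightarrow> 'a :: field poly vec set \<Rightarrow> bool" where
  "convolutional_code n k \<gamma> \<mu> d C \<longleftrightarrow>
     (\<exists>G \<in> carrier_mat k n. reduced_matrix G \<and> C = generated_code G \<and>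
        \<gamma> = constraint_length G \<and> \<mu> = Max (row_degree G ` {..<k}) \<and> d = free_distance C)"

end

(* The BCH code with zeros a, a^2, ..., a^(q+1), where a is a primitive element of the
   field with q^2 elements, has length q^2 - 1 and distance at least q + 2. Frobenius identifies
   the q-th syndrome with the q-th power of the first one, and the (q+1)-st syndrome lies in the
   field with q elements, so there are only 2(q-1) + 1 conditions over that field and the code has
   dimension at least k = n - 2q + 1. Take independent codewords b_0, ..., b_(k-1), a vector b_k
   outside their span, and the generator matrix with rows b_0, ..., b_(k-2), b_(k-1) + D b_k. The
   lowest nonzero coefficient vector of any codeword is a nonzero BCH codeword, which bounds the
   free distance. *)

theory Submission
  imports Defs "HOL-Algebra.Algebraic_Closure_Type" "HOL-Library.Function_Algebras"
    "HOL-Number_Theory.Residues"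
begin

hide_const (open) Divisibility.prime up_ring.monom up_ring.coeff Polynomials.degree Polynomials.lead_coeff

section \<open>Roots of unity and Frobenius in finite characteristic\<close>

text \<open>A double root of X^n - 1 would also be a root of its derivative n X^(n-1), which
  vanishes only at 0. With n = q^2 - 1 this supplies the code locators inside an algebraic closure,
  without constructing the field with q^2 elements.\<close>

lemma card_roots_unity_alg_closed:
  assumes "n > 0" and "of_nat n \<noteq> (0 :: 'a :: alg_closed_field)"
  shows "card {x :: 'a. x ^ n = 1} = n"
proof -
  define p :: "'a poly" where "p = monom 1 n - 1"
  have poly_p: "poly p x = x ^ n - 1" for x
    by (simp add: p_def poly_monom)
  have deg: "degree p = n"
  proof -
    have "degree (monom (1::'a) n + (-1)) = n"
      using assms(1) by (subst degree_add_eq_left) (auto simp: degree_monom_eq)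
    thus ?thesis by (simp add: p_def)
  qed
  hence p0: "p \<noteq> 0" using assms(1) by auto
  from alg_closed_imp_factorization[OF p0] deg obtain A where A: "size A = n"
    "p = smult (lead_coeff p) (\<Prod>x\<in>#A. [:-x, 1:])" by auto
  have roots: "{x. x ^ n = 1} = set_mset A"
  proof -
    have "poly p x = 0 \<longleftrightarrow> x \<in># A" for x
      by (subst A(2)) (use p0 in \<open>auto simp: poly_prod_mset prod_mset_zero_iff\<close>)
    thus ?thesis by (auto simp: poly_p)
  qed
  have "count A x = 1" if x: "x \<in># A" for x
  proof (rule ccontr)
    assume "count A x \<noteq> 1"
    moreover have "count A x > 0" using x by simp
    ultimately have "count A x \<ge> 2" by linarith
    hence "replicate_mset 2 x \<subseteq># A" by (simp add: count_le_replicate_mset_subset_eq)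
    then obtain B where "A = replicate_mset 2 x + B" by (metis subset_mset.less_eqE)
    hence "A = {#x, x#} + B" by (simp add: numeral_2_eq_2)
    hence "(\<Prod>x\<in>#A. [:-x, 1:]) = [:-x, 1:] * ([:-x, 1:] * (\<Prod>x\<in>#B. [:-x, 1:]))"
      by (simp only: image_mset_union image_mset_add_mset image_mset_empty prod_mset.union
            prod_mset.add_mset prod_mset.empty mult_1_right mult.assoc)
    hence "p = [:-x, 1:] * ([:-x, 1:] * smult (lead_coeff p) (\<Prod>x\<in>#B. [:-x, 1:]))"
      using A(2) by (simp only: mult_smult_right)
    then obtain r where "p = [:-x, 1:] * ([:-x, 1:] * r)" by blast
    hence "poly (pderiv p) x = 0" by (simp only: pderiv_mult poly_add poly_mult) simp
    moreover have "pderiv p = monom (of_nat n) (n - 1)"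
      by (simp add: p_def pderiv_diff pderiv_monom)
    ultimately have "x = 0" using assms by (simp add: poly_monom)
    moreover have "x ^ n = 1" using x roots by auto
    ultimately show False using assms(1) by (simp add: power_0_left)
  qed
  hence "size A = (\<Sum>x\<in>set_mset A. 1)"
    by (subst size_multiset_overloaded_eq) (intro sum.cong, auto)
  thus ?thesis using A(1) roots by simp
qed

text \<open>The characteristic divides the cardinality, a power of a single prime, hence is that
  prime. This is what makes the \<open>q\<close>-th power map additive.\<close>

lemma finite_field_CHAR_card:
  assumes "primepow (card (UNIV :: 'a :: {field, finite} set))"
  obtains m where "prime CHAR('a)" "card (UNIV :: 'a set) = CHAR('a) ^ m"
proof -
  from assms obtain p m where pm: "prime p" "card (UNIV :: 'a set) = p ^ m"
    unfolding primepow_def by auto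
  have "CHAR('a) > 0" by (rule finite_imp_CHAR_pos) auto
  hence prime: "prime CHAR('a)" by (rule prime_CHAR_semidom)
  moreover have "CHAR('a) dvd p ^ m" using CHAR_dvd_CARD[where 'a='a] pm by simp
  ultimately have "CHAR('a) = p" using pm(1)
    by (metis prime_dvd_power primes_dvd_imp_eq)
  with pm prime that show thesis by auto
qed

text \<open>Multiplication by a nonzero \<open>x\<close> permutes the nonzero elements; comparing
  the products before and after gives the exponent.\<close>

lemma power_card_eq_same:
  fixes x :: "'a :: {field, finite}"
  shows "x ^ card (UNIV :: 'a set) = x"
proof (cases "x = 0")
  case False
  define U where "U = (UNIV - {0} :: 'a set)"
  have "bij_betw ((*) x) U U"
    by (rule bij_betwI[where g = "\<lambda>y. y / x"]) (use False in \<open>auto simp: U_def\<close>)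
  hence "\<Prod>U = (\<Prod>y\<in>U. x * y)" by (rule prod.reindex_bij_betw[symmetric])
  also have "\<dots> = x ^ card U * \<Prod>U" by (simp add: prod.distrib)
  finally have "x ^ card U = 1" by (simp add: U_def)
  moreover have "card (UNIV :: 'a set) = Suc (card U)"
    unfolding U_def by (rule card.remove) auto
  ultimately show ?thesis by simp
qed (simp add: power_0_left finite_UNIV_card_ge_0)

text \<open>In the algebraic closure, the fixed points for exponents q and q^2 are the subfields in
  which the syndromes lie; the bound counts roots of X^m - X.\<close>

lemma fixed_points_power:
  assumes "m > 1"
  shows "finite {x :: 'a :: idom. x ^ m = x}" "card {x :: 'a. x ^ m = x} \<le> m"
proof -
  define p :: "'a poly" where "p = monom 1 m - monom 1 1"
  have deg: "degree p = m"
  proof -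
    have "degree (monom (1::'a) m + (- monom 1 1)) = m"
      using assms by (subst degree_add_eq_left) (auto simp: degree_monom_eq)
    thus ?thesis by (simp add: p_def)
  qed
  hence p0: "p \<noteq> 0" using assms by auto
  have eq: "{x. x ^ m = x} = {x. poly p x = 0}" by (auto simp: p_def poly_monom)
  show "finite {x :: 'a. x ^ m = x}" unfolding eq using p0 by (rule poly_roots_finite)
  show "card {x :: 'a. x ^ m = x} \<le> m"
    unfolding eq using card_poly_roots_bound[OF p0] deg by simp
qed

section \<open>Counting and duality for words over a finite field\<close>

text \<open>Words of length \<open>n\<close> are encoded as functions vanishing from
  \<open>n\<close> on, which fits the pointwise vector space of functions on \<open>nat\<close>.
  Restriction turns them into extensional functions, which are easy to count.\<close>

lemma supported_funs_bij:
  "bij_betw (\<lambda>v. restrict v {..<n}) {v :: nat \<Rightarrow> 'a :: zero. \<forall>i\<ge>n. v i = 0} ({..<n} \<rightarrow>\<^sub>E UNIV)"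
  by (rule bij_betwI[where g = "\<lambda>v i. if i < n then v i else 0"])
     (auto simp: fun_eq_iff PiE_def extensional_def)

lemma finite_supported_funs: "finite {v :: nat \<Rightarrow> 'a :: {zero, finite}. \<forall>i\<ge>n. v i = 0}"
  and card_supported_funs:
    "card {v :: nat \<Rightarrow> 'a :: {zero, finite}. \<forall>i\<ge>n. v i = 0} = card (UNIV :: 'a set) ^ n"
proof -
  note bij = supported_funs_bij[where 'a='a and n=n]
  have fin: "finite ({..<n} \<rightarrow>\<^sub>E (UNIV :: 'a set))" by (intro finite_PiE) auto
  show "finite {v :: nat \<Rightarrow> 'a. \<forall>i\<ge>n. v i = 0}"
    using fin bij_betw_finite[OF bij] by simp
  show "card {v :: nat \<Rightarrow> 'a. \<forall>i\<ge>n. v i = 0} = card (UNIV :: 'a set) ^ n"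
    using bij_betw_same_card[OF bij] by (simp add: card_PiE)
qed

lemma sum_fun_apply: "(\<Sum>x\<in>A. f x) y = (\<Sum>x\<in>A. f x y)"
  for f :: "'a \<Rightarrow> 'b \<Rightarrow> 'c :: comm_monoid_add"
  by (induction A rule: infinite_finite_induct) auto

text \<open>Since \<open>m\<close> vectors span at most q^m words, a basis of the span of
  \<open>W\<close> has at least \<open>k\<close> elements, and \<open>k\<close> of them cannot span
  all words of length \<open>n\<close>. This leaves room for one more independent vector
  \<open>b k\<close>. The \<open>h j\<close> represent the coordinate functionals.\<close>

lemma independent_with_dual:
  fixes W :: "(nat \<Rightarrow> 'a :: {field, finite}) set"
  assumes supp: "\<And>v i. v \<in> W \<Longrightarrow> i \<ge> n \<Longrightarrow> v i = 0"
    and card: "card (UNIV :: 'a set) ^ k \<le> card W" and "k < n"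
  obtains b h where "\<And>i. i < k \<Longrightarrow> b i \<in> W"
    "\<And>i j. i \<le> k \<Longrightarrow> j \<le> k \<Longrightarrow> (\<Sum>l<n. b i l * h j l) = (if i = j then 1 else (0 :: 'a))"
proof -
  define q where "q = card (UNIV :: 'a set)"
  have q1: "q > 1"
  proof -
    have "card {0, 1 :: 'a} \<le> q" unfolding q_def by (rule card_mono) auto
    thus ?thesis by simp
  qed
  interpret V: vector_space "\<lambda>(a::'a) (v :: nat \<Rightarrow> 'a) i. a * v i"
    by unfold_locales (auto simp: algebra_simps fun_eq_iff)
  interpret P: vector_space_pair "\<lambda>(a::'a) (v :: nat \<Rightarrow> 'a) i. a * v i" "(*) :: 'a \<Rightarrow> _"
    by unfold_locales (auto simp: algebra_simps)
  define F where "F = {v :: nat \<Rightarrow> 'a. \<forall>i\<ge>n. v i = 0}"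
  have F: "finite F" "card F = q ^ n"
    unfolding F_def q_def by (simp_all add: finite_supported_funs card_supported_funs)
  have WF: "W \<subseteq> F" using supp by (auto simp: F_def)
  obtain B where B: "B \<subseteq> W" "V.independent B" "W \<subseteq> V.span B"
    using V.maximal_independent_subset[of W] by blast
  have finB: "finite B" using B(1) WF F(1) by (meson finite_subset)
  have span_card: "finite (V.span Y) \<and> card (V.span Y) \<le> q ^ card Y" if "finite Y" for Y
  proof -
    have span_eq: "V.span Y = (\<lambda>u. \<Sum>v\<in>Y. (\<lambda>i. u v * v i)) ` (Y \<rightarrow>\<^sub>E UNIV)"
      unfolding V.span_finite[OF that]
    proof (intro equalityI subsetI)
      fix y assume "y \<in> range (\<lambda>u. \<Sum>v\<in>Y. (\<lambda>i. u v * v i))"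
      then obtain u where "y = (\<Sum>v\<in>Y. (\<lambda>i. u v * v i))" by blast
      also have "\<dots> = (\<Sum>v\<in>Y. (\<lambda>i. restrict u Y v * v i))" by (intro sum.cong) auto
      finally show "y \<in> (\<lambda>u. \<Sum>v\<in>Y. (\<lambda>i. u v * v i)) ` (Y \<rightarrow>\<^sub>E UNIV)"
        by (intro image_eqI[where x = "restrict u Y"]) auto
    qed blast
    have PiE: "finite (Y \<rightarrow>\<^sub>E (UNIV :: 'a set))" "card (Y \<rightarrow>\<^sub>E (UNIV :: 'a set)) = q ^ card Y"
      using that by (auto simp: finite_PiE card_PiE q_def)
    show ?thesis
      using PiE card_image_le[OF PiE(1)] unfolding span_eq by (auto intro: finite_imageI)
  qed
  have "q ^ k \<le> q ^ card B"
  proof -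
    have "q ^ k \<le> card W" using card by (simp add: q_def)
    also have "\<dots> \<le> card (V.span B)" using B(3) span_card[OF finB] by (intro card_mono) auto
    also have "\<dots> \<le> q ^ card B" using span_card[OF finB] by simp
    finally show ?thesis .
  qed
  hence "k \<le> card B" using q1 by simp
  then obtain B' where B': "B' \<subseteq> B" "card B' = k" "finite B'"
    using finB by (meson obtain_subset_with_card_n)
  have "\<not> F \<subseteq> V.span B'"
  proof
    assume "F \<subseteq> V.span B'"
    hence "q ^ n \<le> q ^ k" using span_card[OF B'(3)] B'(2) F(2)
      card_mono[of "V.span B'" F] by auto
    thus False using q1 \<open>k < n\<close> by simp
  qed
  then obtain x where x: "x \<in> F" "x \<notin> V.span B'" by blast
  have indep: "V.independent (insert x B')"
    using x(2) V.independent_mono[OF B(2) B'(1)] by (rule V.independent_insertI)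
  obtain f where f: "bij_betw f {..<k} B'"
    using ex_bij_betw_nat_finite[OF B'(3)] B'(2) by (auto simp: atLeast0LessThan)
  define b where "b = f(k := x)"
  have b_in: "b i \<in> W" if "i < k" for i
    using that f B'(1) B(1) by (auto simp: b_def bij_betw_def)
  have b_ins: "b i \<in> insert x B'" if "i \<le> k" for i
    using that f by (cases "i = k") (auto simp: b_def bij_betw_def)
  have b_F: "b i \<in> F" if "i \<le> k" for i
    using b_ins[OF that] x(1) B'(1) B(1) WF by auto
  have b_inj: "b i = b j \<longleftrightarrow> i = j" if "i \<le> k" "j \<le> k" for i j
  proof -
    have "inj_on f {..<k}" "x \<notin> f ` {..<k}"
      using f x(2) V.span_base by (auto simp: bij_betw_def)
    thus ?thesis using that by (auto simp: b_def inj_on_def)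
  qed
  \<comment> \<open>The unit words: a functional \<open>g\<close> on words of length
    \<open>n\<close> is the pairing with its values at \<open>e l\<close>, which become the entries
    of \<open>h j\<close>.\<close>
  define e :: "nat \<Rightarrow> nat \<Rightarrow> 'a" where "e = (\<lambda>l i. if i = l then 1 else 0)"
  have "\<forall>j\<in>{..k}. \<exists>h. \<forall>i\<le>k. (\<Sum>l<n. b i l * h l) = (if i = j then 1 else 0)"
  proof
    fix j assume "j \<in> {..k}"
    hence j: "j \<le> k" by simp
    obtain g where g: "Vector_Spaces.linear (\<lambda>(a::'a) (v :: nat \<Rightarrow> 'a) i. a * v i) (*) g"
      "\<forall>v\<in>insert x B'. g v = (if v = b j then 1 else 0)"
      using P.linear_independent_extend[OF indep, of "\<lambda>v. if v = b j then 1 else 0"] by blast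
    interpret g: Vector_Spaces.linear "\<lambda>(a::'a) (v :: nat \<Rightarrow> 'a) i. a * v i" "(*)" g by fact
    have "(\<Sum>l<n. b i l * g (e l)) = (if i = j then 1 else 0)" if i: "i \<le> k" for i
    proof -
      have "b i = (\<Sum>l<n. (\<lambda>m. b i l * e l m))"
      proof
        fix m
        have "(\<Sum>l<n. (\<lambda>m. b i l * e l m)) m = (\<Sum>l<n. if m = l then b i l else 0)"
          unfolding sum_fun_apply by (intro sum.cong) (auto simp: e_def)
        also have "\<dots> = b i m"
          using b_F[OF i] by (auto simp: F_def not_less)
        finally show "b i m = (\<Sum>l<n. (\<lambda>m. b i l * e l m)) m" ..
      qed
      hence "g (b i) = g (\<Sum>l<n. (\<lambda>m. b i l * e l m))" by (rule arg_cong)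
      also have "\<dots> = (\<Sum>l<n. b i l * g (e l))" by (simp add: g.sum g.scale)
      finally show ?thesis using g(2) b_ins[OF i] b_inj[OF i j] by auto
    qed
    thus "\<exists>h. \<forall>i\<le>k. (\<Sum>l<n. b i l * h l) = (if i = j then 1 else 0)"
      by (intro exI[of _ "\<lambda>l. g (e l)"]) auto
  qed
  from bchoice[OF this] obtain h
    where "\<forall>j\<in>{..k}. \<forall>i\<le>k. (\<Sum>l<n. b i l * h j l) = (if i = j then 1 else 0)" ..
  with b_in show thesis by (intro that[of b h]) auto
qed

section \<open>The BCH code and its syndromes\<close>

text \<open>\<open>W\<close> is the common kernel of the syndromes. Its size is bounded below by
  counting syndrome values, and the product form of the last inequality avoids division.\<close>

lemma BCH_subspace:
  assumes "primepow q" and "q \<ge> 4" and "card (UNIV :: 'a :: {field, finite} set) = q"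
  obtains W :: "(nat \<Rightarrow> 'a :: {field, finite}) set" where
    "\<And>v i. v \<in> W \<Longrightarrow> i \<ge> q\<^sup>2 - 1 \<Longrightarrow> v i = 0"
    "\<And>v w. v \<in> W \<Longrightarrow> w \<in> W \<Longrightarrow> (\<lambda>i. v i + w i) \<in> W" "\<And>a v. v \<in> W \<Longrightarrow> (\<lambda>i. a * v i) \<in> W"
    "\<And>v. v \<in> W \<Longrightarrow> \<exists>i. v i \<noteq> 0 \<Longrightarrow> card {i. v i \<noteq> 0} \<ge> q + 2"
    "q ^ (q\<^sup>2 - 1) \<le> q ^ (2 * q - 1) * card W"
proof -
  define n where "n = q\<^sup>2 - 1"
  have "1 < q\<^sup>2" using assms(2) by (intro one_less_power) auto
  hence q2: "q\<^sup>2 = Suc n" "n > 0" by (auto simp: n_def)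
  obtain m where m: "prime CHAR('a)" "q = CHAR('a) ^ m"
    using finite_field_CHAR_card[where 'a='a] assms by auto
  have frob_sum: "(\<Sum>i\<in>A. f i) ^ q = (\<Sum>i\<in>A. f i ^ q)" for f :: "nat \<Rightarrow> 'a alg_closure" and A
    using m by (intro freshmans_dream_sum') auto
  have to_ac_q: "to_ac a ^ q = to_ac a" for a :: 'a
    using power_card_eq_same[of a] assms(3) by (simp flip: to_ac_power)
  \<comment> \<open>As q vanishes in the field, so does n + 1 = q^2; hence n equals -1 there and is
    nonzero.\<close>
  have "of_nat q = (0 :: 'a alg_closure)"
    using CHAR_dvd_CARD[where 'a='a] assms(3) by (simp add: of_nat_eq_0_iff_char_dvd)
  hence "of_nat (Suc n) = (0 :: 'a alg_closure)" unfolding q2(1)[symmetric] by simp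
  hence "of_nat n \<noteq> (0 :: 'a alg_closure)" by auto
  from card_roots_unity_alg_closed[OF q2(2) this]
  have card_S: "card {x :: 'a alg_closure. x ^ n = 1} = n" .
  hence "finite {x :: 'a alg_closure. x ^ n = 1}" using q2(2) by (metis card.infinite less_not_refl)
  with card_S obtain s :: "nat \<Rightarrow> 'a alg_closure" where s: "bij_betw s {..<n} {x. x ^ n = 1}"
    using ex_bij_betw_nat_finite by (metis atLeast0LessThan)
  have s_n: "s i ^ n = 1" if "i < n" for i using s that by (auto simp: bij_betw_def)
  hence s_nz: "s i \<noteq> 0" if "i < n" for i using that q2(2) by (metis power_0_left less_not_refl zero_neq_one)
  have s_q2: "s i ^ q\<^sup>2 = s i" if "i < n" for i using s_n[OF that] by (simp add: q2(1))
  have s_inj: "s i = s j \<longleftrightarrow> i = j" if "i < n" "j < n" for i j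
    using s that by (auto simp: bij_betw_def inj_on_def)

  \<comment> \<open>The \<open>j\<close>-th syndrome, with the \<open>n\<close>-th roots of unity
    \<open>s i\<close> as locators in an arbitrary order.\<close>
  define syn where "syn = (\<lambda>(c :: nat \<Rightarrow> 'a) j. \<Sum>i<n. to_ac (c i) * s i ^ j)"
  \<comment> \<open>The \<open>q\<close>-th power map is additive and fixes the coefficients of
    \<open>c\<close>, so it only multiplies the exponents of the locators.\<close>
  have syn_pow: "syn c j ^ q = syn c (j * q)" for c j
    unfolding syn_def frob_sum by (simp add: power_mult_distrib to_ac_q power_mult)
  have syn_cong: "syn c (j + q\<^sup>2) = syn c (Suc j)" for c j
    unfolding syn_def by (intro sum.cong) (auto simp: power_add s_q2 mult_ac)
  have syn_E: "syn c j ^ q\<^sup>2 = syn c j" for c j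
  proof -
    have "syn c j ^ q\<^sup>2 = syn c (j * q\<^sup>2)"
      by (simp add: power2_eq_square power_mult syn_pow mult.assoc)
    also have "\<dots> = syn c j"
      unfolding syn_def by (intro sum.cong) (auto simp: power_mult s_q2 mult.commute[of j])
    finally show ?thesis .
  qed
  \<comment> \<open>The index (q + 1) q = q + q^2 reduces to q + 1, because exponent q^2 acts on
    locators like exponent 1.\<close>
  have syn_Fq: "syn c (q + 1) ^ q = syn c (q + 1)" for c
    using syn_cong[of c q] unfolding syn_pow by (simp add: power2_eq_square algebra_simps)
  define F where "F = {c :: nat \<Rightarrow> 'a. \<forall>i\<ge>n. c i = 0}"
  have F: "finite F" "card F = q ^ n"
    unfolding F_def using assms(3) by (simp_all add: finite_supported_funs card_supported_funs)
  \<comment> \<open>Index \<open>q\<close> is omitted: that syndrome is the \<open>q\<close>-th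
    power of the first and vanishes with it.\<close>
  define I where "I = insert (q + 1) {1..<q}"
  define W where "W = {c \<in> F. \<forall>j\<in>I. syn c j = 0}"
  have dist: "card {i. c i \<noteq> 0} \<ge> q + 2" if c: "c \<in> W" "\<exists>i. c i \<noteq> 0" for c
  proof (rule ccontr)
    define P where "P = {i. c i \<noteq> 0}"
    assume "\<not> ?thesis"
    hence P: "card P \<le> q + 1" by (simp add: P_def)
    have Pn: "P \<subseteq> {..<n}" using c(1) by (auto simp: P_def W_def F_def not_less[symmetric])
    from c(2) obtain i0 where i0: "i0 \<in> P" by (auto simp: P_def)
    have finP: "finite P" using Pn finite_subset by blast
    \<comment> \<open>\<open>r\<close> vanishes at every locator of the support except that of
      \<open>i0\<close>. Weighting the syndromes 1, ..., q + 1 by its coefficients isolates the term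
      of \<open>i0\<close>, so \<open>r\<close> would vanish there too, although the locators are
      distinct.\<close>
    define r where "r = (\<Prod>i\<in>P - {i0}. [:- s i, 1:])"
    have "degree r = card (P - {i0})"
      unfolding r_def by (subst degree_prod_eq_sum_degree) auto
    also have "\<dots> \<le> q" using P i0 finP by (simp add: card_Diff_singleton)
    finally have deg: "degree r \<le> q" .
    have syn0: "syn c (Suc j) = 0" if jq: "j \<le> q" for j
    proof -
      have I0: "syn c j = 0" if "j \<in> I" for j using c(1) that by (auto simp: W_def)
      consider "Suc j \<in> I" | "Suc j = q" using jq by (force simp: I_def)
      thus ?thesis
      proof cases
        case 2
        have "syn c 1 = 0" using assms(2) by (intro I0) (auto simp: I_def)
        hence "syn c (1 * q) = 0" using assms(2) by (subst syn_pow[symmetric]) simp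
        thus ?thesis using 2 by simp
      qed (rule I0)
    qed
    have poly_r: "poly r (s i) = 0" if "i \<in> P - {i0}" for i
      using that finP by (auto simp: r_def poly_prod)
    have "0 = (\<Sum>j\<le>degree r. coeff r j * syn c (Suc j))"
      using deg by (intro sum.neutral[symmetric]) (auto simp: syn0)
    also have "\<dots> = (\<Sum>i<n. to_ac (c i) * s i * poly r (s i))"
      unfolding syn_def poly_altdef sum_distrib_left by (subst sum.swap) (simp add: mult_ac)
    also have "\<dots> = (\<Sum>i\<in>{i0}. to_ac (c i) * s i * poly r (s i))"
      using i0 Pn poly_r by (intro sum.mono_neutral_right) (auto simp: P_def)
    finally have "poly r (s i0) = 0" using i0 Pn s_nz[of i0] by (auto simp: P_def)
    then obtain i where "i \<in> P - {i0}" "s i0 = s i"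
      using finP by (auto simp: r_def poly_prod)
    thus False using s_inj[of i0 i] i0 Pn by auto
  qed

  \<comment> \<open>The possible values of each syndrome: at most q for index q + 1 and at most q^2
    for each of the q - 1 others, in total q^(2q-1) combinations.\<close>
  define E where "E = (\<lambda>j. {x :: 'a alg_closure. x ^ (if j = q + 1 then q else q\<^sup>2) = x})"
  define T where "T = PiE I E"
  have finE: "finite (E j)" for j
    unfolding E_def using assms(2) q2 by (intro fixed_points_power) auto
  have card_T: "finite T" "card T \<le> q ^ (2 * q - 1)"
  proof -
    have finI: "finite I" by (simp add: I_def)
    show "finite T" unfolding T_def using finI finE by (intro finite_PiE)
    have "card T = (\<Prod>j\<in>I. card (E j))" unfolding T_def using finI by (rule card_PiE)
    also have "\<dots> \<le> (\<Prod>j\<in>I. if j = q + 1 then q else q\<^sup>2)"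
    proof (rule prod_mono)
      fix j
      have "1 < (if j = q + 1 then q else q\<^sup>2)" using assms(2) q2 by auto
      from fixed_points_power(2)[OF this, where 'a="'a alg_closure"]
      show "0 \<le> card (E j) \<and> card (E j) \<le> (if j = q + 1 then q else q\<^sup>2)" unfolding E_def by simp
    qed
    also have "\<dots> = q * (\<Prod>j=1..<q. q\<^sup>2)"
      unfolding I_def by (subst prod.insert) (auto intro!: prod.cong)
    also have "\<dots> = q ^ Suc (2 * (q - 1))" by (simp add: power_mult)
    also have "Suc (2 * (q - 1)) = 2 * q - 1" using assms(2) by simp
    finally show "card T \<le> q ^ (2 * q - 1)" .
  qed
  define \<Phi> where "\<Phi> = (\<lambda>c. restrict (syn c) I)"
  have \<Phi>_T: "\<Phi> c \<in> T" for c
    unfolding T_def \<Phi>_def E_def using syn_E[of c] syn_Fq[of c] by (auto simp del: One_nat_def)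
  \<comment> \<open>A nonempty fiber of the linear syndrome map is a translate of its kernel
    \<open>W\<close>.\<close>
  have fiber: "card {c \<in> F. \<Phi> c = t} \<le> card W" for t
  proof (cases "\<exists>c0\<in>F. \<Phi> c0 = t")
    case True
    then obtain c0 where c0: "c0 \<in> F" "\<Phi> c0 = t" by blast
    have "inj_on (\<lambda>c i. c i - c0 i) {c \<in> F. \<Phi> c = t}"
      by (auto simp: inj_on_def fun_eq_iff)
    moreover have "(\<lambda>c i. c i - c0 i) ` {c \<in> F. \<Phi> c = t} \<subseteq> W"
    proof safe
      fix c assume c: "c \<in> F" "t = \<Phi> c"
      have "syn (\<lambda>i. c i - c0 i) j = syn c j - syn c0 j" for j
        by (simp add: syn_def algebra_simps sum_subtractf)
      moreover have "syn c j = syn c0 j" if "j \<in> I" for j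
        using c(2) c0(2) that by (auto simp: \<Phi>_def dest!: fun_cong[of _ _ j])
      ultimately show "(\<lambda>i. c i - c0 i) \<in> W" using c(1) c0(1) by (auto simp: W_def F_def)
    qed
    moreover have "finite W" using F(1) by (simp add: W_def)
    ultimately show ?thesis by (rule card_inj_on_le)
  next
    case False
    hence "{c \<in> F. \<Phi> c = t} = {}" by blast
    thus ?thesis by (simp only: card.empty)
  qed
  have "card F \<le> (\<Sum>t\<in>T. card {c \<in> F. \<Phi> c = t})"
  proof -
    have "F = (\<Union>t\<in>T. {c \<in> F. \<Phi> c = t})" using \<Phi>_T by auto
    thus ?thesis using card_UN_le[OF card_T(1), of "\<lambda>t. {c \<in> F. \<Phi> c = t}"] by simp
  qed
  also have "\<dots> \<le> card T * card W" using sum_bounded_above[of T, OF fiber] by simp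
  also have "\<dots> \<le> q ^ (2 * q - 1) * card W" using card_T(2) by (rule mult_right_mono) simp
  finally have count: "q ^ n \<le> q ^ (2 * q - 1) * card W" by (simp add: F(2))

  show thesis
  proof (rule that[of W, folded n_def])
    show "(\<lambda>i. v i + w i) \<in> W" if "v \<in> W" "w \<in> W" for v w
      using that by (auto simp: W_def F_def syn_def algebra_simps sum.distrib)
    show "(\<lambda>i. a * v i) \<in> W" if "v \<in> W" for a v
    proof -
      have "syn (\<lambda>i. a * v i) j = to_ac a * syn v j" for j
        by (simp add: syn_def sum_distrib_left mult_ac)
      thus ?thesis using that by (auto simp: W_def F_def)
    qed
  qed (use dist count in \<open>auto simp: W_def F_def\<close>)
qed

section \<open>Unit-memory convolutional codes from a dual system\<close>

lemma sum_const_poly: "(\<Sum>i\<in>A. [:f i:]) = [:\<Sum>i\<in>A. f i:]"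
  by (induction A rule: infinite_finite_induct) auto

lemma sum_linear_poly: "(\<Sum>i\<in>A. [:f i, g i:]) = [:\<Sum>i\<in>A. f i, \<Sum>i\<in>A. g i:]"
  by (induction A rule: infinite_finite_induct) auto

text \<open>Duality up to index \<open>k\<close> encodes the independence of \<open>b 0\<close>,
  ..., \<open>b k\<close> and at the same time supplies a right inverse of the generator
  matrix.\<close>

locale unit_memory_code =
  fixes n k :: nat and b h :: "nat \<Rightarrow> nat \<Rightarrow> 'a :: field"
  assumes k_pos: "0 < k" and k_less: "k < n"
    and dual: "\<And>i j. i \<le> k \<Longrightarrow> j \<le> k \<Longrightarrow> (\<Sum>l<n. b i l * h j l) = (if i = j then 1 else 0)"
begin

definition G :: "'a poly mat" where
  "G = mat k n (\<lambda>(i, l). [:b i l, if Suc i = k then b k l else 0:])"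

definition H :: "'a poly mat" where
  "H = mat n k (\<lambda>(l, i). [:h i l:])"

lemma dims [simp]: "G \<in> carrier_mat k n" "H \<in> carrier_mat n k"
  "dim_row G = k" "dim_col G = n" "dim_row H = n" "dim_col H = k"
  by (auto simp: G_def H_def)

text \<open>Pairing the combination with \<open>h j\<close> recovers the coefficient
  \<open>a j\<close>.\<close>

lemma nonzero_combination:
  assumes "\<exists>i<k. a i \<noteq> 0"
  shows "\<exists>l<n. (\<Sum>i<k. a i * b i l) \<noteq> 0"
proof (rule ccontr)
  assume zero: "\<not> ?thesis"
  from assms obtain j where j: "j < k" "a j \<noteq> 0" by blast
  have "0 = (\<Sum>l<n. (\<Sum>i<k. a i * b i l) * h j l)"
    using zero by (intro sum.neutral[symmetric]) auto
  also have "\<dots> = (\<Sum>i<k. a i * (\<Sum>l<n. b i l * h j l))"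
    unfolding sum_distrib_left sum_distrib_right by (subst sum.swap) (simp add: mult_ac)
  also have "\<dots> = (\<Sum>i<k. a i * (if i = j then 1 else 0))"
    using j by (intro sum.cong) (auto simp: dual)
  also have "\<dots> = a j" using j(1) by (simp add: if_distrib cong: if_cong)
  finally show False using j(2) by simp
qed

text \<open>The constant terms give the identity by duality; the \<open>D\<close> term of the last
  row disappears because \<open>b k\<close> pairs to zero with every \<open>h j\<close> for
  \<open>j < k\<close>.\<close>

lemma G_mult_H: "G * H = 1\<^sub>m k"
proof (rule eq_matI)
  fix i j assume "i < dim_row (1\<^sub>m k :: 'a poly mat)" "j < dim_col (1\<^sub>m k :: 'a poly mat)"
  hence ij: "i < k" "j < k" by auto
  have "(G * H) $$ (i, j) = (\<Sum>l<n. [:b i l * h j l, if Suc i = k then b k l * h j l else 0:])"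
    using ij by (auto simp: G_def H_def scalar_prod_def atLeast0LessThan mult_ac intro!: sum.cong)
  also have "\<dots> = [:\<Sum>l<n. b i l * h j l, if Suc i = k then \<Sum>l<n. b k l * h j l else 0:]"
    by (simp add: sum_linear_poly)
  also have "\<dots> = (1\<^sub>m k) $$ (i, j)" using ij by (simp add: dual)
  finally show "(G * H) $$ (i, j) = (1\<^sub>m k) $$ (i, j)" .
qed auto

lemma basic_G: "basic_matrix G"
  unfolding basic_matrix_def using G_mult_H by auto

text \<open>The right inverse, transposed, recovers the message, so encoding is injective.\<close>

lemma decode:
  assumes "u \<in> carrier_vec k"
  shows "transpose_mat H *\<^sub>v (transpose_mat G *\<^sub>v u) = u"
proof -
  have "transpose_mat H *\<^sub>v (transpose_mat G *\<^sub>v u) = (transpose_mat H * transpose_mat G) *\<^sub>v u"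
    using assms by (intro assoc_mult_mat_vec[symmetric]) auto
  also have "transpose_mat H * transpose_mat G = 1\<^sub>m k"
    by (subst transpose_mult[symmetric]) (auto simp: G_mult_H)
  finally show ?thesis using assms by simp
qed

lemma encode_coeff:
  assumes "u \<in> carrier_vec k" "l < n"
  shows "(transpose_mat G *\<^sub>v u) $ l = (\<Sum>i<k. [:b i l, if Suc i = k then b k l else 0:] * u $ i)"
  using assms by (auto simp: G_def scalar_prod_def atLeast0LessThan intro!: sum.cong)

lemma last_row_nonzero: "\<exists>l<n. b k l \<noteq> 0"
proof (rule ccontr)
  assume "\<not> ?thesis"
  hence "(\<Sum>l<n. b k l * h k l) = 0" by (intro sum.neutral) auto
  thus False using dual[of k k] by simp
qed

lemma row_degree_G:
  assumes i: "i < k"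
  shows "row_degree G i = (if Suc i = k then 1 else 0)"
proof -
  have ne: "{..<n} \<noteq> {}" using k_less by auto
  have "degree (G $$ (i, l)) \<le> (if Suc i = k then 1 else 0)" if "l < n" for l
    using that i by (auto simp: G_def)
  hence le: "row_degree G i \<le> (if Suc i = k then 1 else 0)"
    unfolding row_degree_def using ne by (subst Max_le_iff) auto
  show ?thesis
  proof (cases "Suc i = k")
    case True
    from last_row_nonzero obtain l where l: "l < n" "b k l \<noteq> 0" by blast
    hence "degree (G $$ (i, l)) = 1" using True i by (auto simp: G_def)
    hence "1 \<le> row_degree G i"
      unfolding row_degree_def using l(1) by (intro Max_ge) (auto simp: image_iff intro!: bexI[of _ l])
    thus ?thesis using le True by simp
  qed (use le in simp)
qed

lemma constraint_length_G: "constraint_length G = 1"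
proof -
  have "constraint_length G = (\<Sum>i<k. if i = k - 1 then 1 else 0)"
    unfolding constraint_length_def using k_pos by (intro sum.cong) (auto simp: row_degree_G)
  thus ?thesis using k_pos by simp
qed

lemma memory_G: "Max (row_degree G ` {..<k}) = 1"
proof (rule Max_eqI)
  show "1 \<in> row_degree G ` {..<k}"
    using k_pos by (intro image_eqI[of _ _ "k - 1"]) (auto simp: row_degree_G)
qed (auto simp: row_degree_G)

text \<open>A constant generator matrix would make the code closed under taking coefficients, so the
  coefficient vector \<open>b k\<close> of \<open>D\<close> in the last row would be a codeword; but it is annihilated by
  the right inverse of \<open>G\<close>.\<close>

lemma reduced_G: "reduced_matrix G"
  unfolding reduced_matrix_def
proof (intro conjI allI impI basic_G)
  fix G' :: "'a poly mat"
  assume "dim_col G' = dim_col G \<and> basic_matrix G' \<and> generated_code G' = generated_code G"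
  hence G': "dim_col G' = n" "generated_code G' = generated_code G" by auto
  define m where "m = dim_row G'"
  have G'm: "G' \<in> carrier_mat m n" using G'(1) by (auto simp: m_def)
  \<comment> \<open>As \<open>G\<close> has constraint length 1, minimality only requires excluding
    constant competitors.\<close>
  have "constraint_length G' \<noteq> 0"
  proof
    assume "constraint_length G' = 0"
    hence "row_degree G' i = 0" if "i < m" for i
      using that by (auto simp: constraint_length_def m_def)
    hence deg0: "degree (G' $$ (i, l)) = 0" if "i < m" "l < n" for i l
      using that G'(1) unfolding row_degree_def
      by (metis (no_types, lifting) Max_ge finite_imageI finite_lessThan image_eqI le_zero_eq lessThan_iff)
    hence const: "G' $$ (i, l) = [:coeff (G' $$ (i, l)) 0:]" if "i < m" "l < n" for i l
      using deg0[OF that] by (simp add: degree_0_id)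
    \<comment> \<open>The message selecting the last row of \<open>G\<close>, the only row with a
      \<open>D\<close> term.\<close>
    define e :: "'a poly vec" where "e = unit_vec k (k - 1)"
    define x where "x = vec n (\<lambda>l. [:b k l:])"
    have "transpose_mat G *\<^sub>v e \<in> generated_code G'"
      unfolding G'(2) unfolding generated_code_def e_def by (intro CollectI exI conjI refl) auto
    then obtain u where u: "u \<in> carrier_vec m" "transpose_mat G *\<^sub>v e = transpose_mat G' *\<^sub>v u"
      by (auto simp: generated_code_def m_def)
    \<comment> \<open>Because \<open>G'\<close> is constant, taking the coefficient of
      \<open>D\<close> commutes with encoding, so \<open>u1\<close> is a message for
      \<open>x\<close>.\<close>
    define u1 where "u1 = vec m (\<lambda>i. [:coeff (u $ i) 1:])"
    have "transpose_mat G' *\<^sub>v u1 = x"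
    proof (rule eq_vecI)
      fix l assume "l < dim_vec x"
      hence l: "l < n" by (simp add: x_def)
      have "(transpose_mat G *\<^sub>v e) $ l = (\<Sum>i<k. [:b i l, if Suc i = k then b k l else 0:] * e $ i)"
        using l by (intro encode_coeff) (auto simp: e_def)
      also have "\<dots> = (\<Sum>i<k. if i = k - 1 then [:b i l, b k l:] else 0)"
        by (intro sum.cong) (auto simp: e_def)
      also have "\<dots> = [:b (k - 1) l, b k l:]" using k_pos by simp
      finally have "b k l = coeff ((transpose_mat G' *\<^sub>v u) $ l) 1" using u(2) by simp
      also have "(transpose_mat G' *\<^sub>v u) $ l = (\<Sum>i<m. [:coeff (G' $$ (i, l)) 0:] * u $ i)"
        using l u(1) G'm const[OF _ l, symmetric]
        by (auto simp: scalar_prod_def atLeast0LessThan intro!: sum.cong)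
      also have "coeff \<dots> 1 = (\<Sum>i<m. coeff (G' $$ (i, l)) 0 * coeff (u $ i) 1)"
        by (simp add: coeff_sum)
      finally have "[:b k l:] = (\<Sum>i<m. [:coeff (G' $$ (i, l)) 0 * coeff (u $ i) 1:])"
        by (simp add: sum_const_poly)
      also have "\<dots> = (\<Sum>i<m. G' $$ (i, l) * u1 $ i)"
      proof (intro sum.cong refl)
        fix i assume "i \<in> {..<m}"
        hence i: "i < m" by simp
        show "[:coeff (G' $$ (i, l)) 0 * coeff (u $ i) 1:] = G' $$ (i, l) * u1 $ i"
          by (subst (2) const[OF i l]) (use i in \<open>simp add: u1_def\<close>)
      qed
      also have "\<dots> = (transpose_mat G' *\<^sub>v u1) $ l"
        using l G'm by (auto simp: u1_def scalar_prod_def atLeast0LessThan intro!: sum.cong)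
      finally show "(transpose_mat G' *\<^sub>v u1) $ l = x $ l" using l by (simp add: x_def)
    qed (use G'm in \<open>auto simp: x_def\<close>)
    hence "x \<in> generated_code G"
      unfolding G'(2)[symmetric] unfolding generated_code_def m_def[symmetric]
      by (auto simp: u1_def intro!: exI[of _ "vec m (\<lambda>i. [:coeff (u $ i) 1:])"])
    then obtain w where w: "w \<in> carrier_vec k" "x = transpose_mat G *\<^sub>v w"
      by (auto simp: generated_code_def)
    \<comment> \<open>The entries of the decoded message are the pairings of \<open>b k\<close> with
      \<open>h j\<close> for \<open>j < k\<close>, all zero; this would force \<open>x\<close>,
      hence \<open>b k\<close>, to vanish.\<close>
    have "w = transpose_mat H *\<^sub>v x" using decode w by simp
    also have "\<dots> = 0\<^sub>v k"
    proof (rule eq_vecI)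
      fix j assume "j < dim_vec (0\<^sub>v k :: 'a poly vec)"
      hence j: "j < k" by simp
      have "(transpose_mat H *\<^sub>v x) $ j = (\<Sum>l<n. [:b k l * h j l:])"
        using j by (auto simp: H_def x_def scalar_prod_def atLeast0LessThan mult_ac intro!: sum.cong)
      thus "(transpose_mat H *\<^sub>v x) $ j = 0\<^sub>v k $ j" using j by (simp add: sum_const_poly dual)
    qed auto
    finally have w0: "w = 0\<^sub>v k" .
    from last_row_nonzero obtain l where l: "l < n" "b k l \<noteq> 0" by blast
    have "x $ l = 0" using w(2) encode_coeff[OF w(1) l(1)] by (simp add: w0)
    thus False using l by (simp add: x_def)
  qed
  thus "constraint_length G \<le> constraint_length G'" by (simp add: constraint_length_G)
qed

lemma convolutional_code_G:
  "convolutional_code n k 1 1 (free_distance (generated_code G)) (generated_code G)"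
  unfolding convolutional_code_def
  using reduced_G constraint_length_G memory_G by (intro bexI[of _ G]) auto

text \<open>The lowest nonzero coefficient vector of a codeword lies in the span of \<open>b 0, ..., b (k - 1)\<close>.\<close>

lemma free_distance_ge:
  assumes d: "\<And>a. \<exists>i<k. a i \<noteq> 0 \<Longrightarrow> d \<le> card {l \<in> {..<n}. (\<Sum>i<k. a i * b i l) \<noteq> 0}"
  shows "d \<le> free_distance (generated_code G)"
  unfolding free_distance_def
proof (rule cInf_greatest)
  \<comment> \<open>The first row of \<open>G\<close> is a nonzero codeword, so the infimum is over
    a nonempty set and the default value 0 does not arise.\<close>
  define e :: "'a poly vec" where "e = unit_vec k 0"
  have e: "e \<in> carrier_vec k" by (simp add: e_def)
  define v where "v = transpose_mat G *\<^sub>v e"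
  have "v \<noteq> 0\<^sub>v (dim_vec v)"
  proof
    assume "v = 0\<^sub>v (dim_vec v)"
    hence "v = 0\<^sub>v n" by (simp add: v_def)
    hence "e = transpose_mat H *\<^sub>v 0\<^sub>v n" using decode[OF e] by (simp add: v_def)
    also have "\<dots> = 0\<^sub>v k" by (intro eq_vecI) auto
    finally have "e $ 0 = 0\<^sub>v k $ 0" by simp
    thus False using k_pos by (simp add: e_def)
  qed
  moreover have "v \<in> generated_code G" using e by (auto simp: v_def generated_code_def)
  ultimately show "{wt v | v. v \<in> generated_code G \<and> v \<noteq> 0\<^sub>v (dim_vec v)} \<noteq> {}" by blast
next
  fix x assume "x \<in> {wt v | v. v \<in> generated_code G \<and> v \<noteq> 0\<^sub>v (dim_vec v)}"
  then obtain u where u: "u \<in> carrier_vec k" "x = wt (transpose_mat G *\<^sub>v u)"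
    and nz: "transpose_mat G *\<^sub>v u \<noteq> 0\<^sub>v n"
    by (auto simp: generated_code_def)
  define v where "v = transpose_mat G *\<^sub>v u"
  have dim_v: "dim_vec v = n" by (simp add: v_def)
  have ex: "\<exists>m. \<exists>i<k. coeff (u $ i) m \<noteq> 0"
  proof (rule ccontr)
    assume "\<not> ?thesis"
    hence "u $ i = 0" if "i < k" for i using that by (auto simp: poly_eq_iff)
    hence "transpose_mat G *\<^sub>v u = 0\<^sub>v n" using encode_coeff[OF u(1)] by (intro eq_vecI) auto
    with nz show False by simp
  qed
  define m where "m = (LEAST m. \<exists>i<k. coeff (u $ i) m \<noteq> 0)"
  have m: "\<exists>i<k. coeff (u $ i) m \<noteq> 0" unfolding m_def using ex by (rule LeastI_ex)
  have below: "coeff (u $ i) r = 0" if "i < k" "r < m" for i r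
    using not_less_Least[of r "\<lambda>m. \<exists>i<k. coeff (u $ i) m \<noteq> 0"] that unfolding m_def by auto
  \<comment> \<open>The \<open>D\<close> term of the last row would contribute the coefficient of
    \<open>u\<close> at \<open>m - 1\<close>, which is zero by minimality of \<open>m\<close>; for
    \<open>m = 0\<close> there is no such contribution.\<close>
  have coeff_v: "coeff (v $ l) m = (\<Sum>i<k. coeff (u $ i) m * b i l)" if l: "l < n" for l
    unfolding v_def encode_coeff[OF u(1) l] coeff_sum
    by (intro sum.cong refl, cases m) (auto simp: below mult_ac coeff_pCons)
  have "d \<le> card {l \<in> {..<n}. (\<Sum>i<k. coeff (u $ i) m * b i l) \<noteq> 0}" using m by (rule d)
  also have "\<dots> = (\<Sum>l<n. if coeff (v $ l) m \<noteq> 0 then 1 else 0)"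
    by (subst sum.If_cases) (auto simp: coeff_v intro!: arg_cong[where f = card])
  \<comment> \<open>Each counted position contributes at least its coefficient of degree
    \<open>m\<close> to the weight.\<close>
  also have "\<dots> \<le> wt v"
    unfolding wt_def dim_v
  proof (rule sum_mono)
    fix l
    have "finite {i. coeff (v $ l) i \<noteq> 0}"
      by (rule finite_subset[of _ "{..degree (v $ l)}"]) (auto intro: le_degree)
    thus "(if coeff (v $ l) m \<noteq> 0 then 1 else 0) \<le> card {i. coeff (v $ l) i \<noteq> 0}"
      by (auto simp: Suc_le_eq card_gt_0_iff)
  qed
  finally show "d \<le> x" using u(2) by (simp add: v_def)
qed

end

section \<open>The convolutional code obtained from the BCH code\<close>

theorem theorem5p6:
  fixes q n :: nat
  assumes "primepow q" and "q \<ge> 4" and "n = q\<^sup>2 - 1"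
    and "card (UNIV :: 'a :: {field, finite} set) = q"
  shows "\<exists>(C :: 'a poly vec set) d. convolutional_code n (n - 2 * q + 1) 1 1 d C \<and> d \<ge> q + 2"
proof -
  define k where "k = n - 2 * q + 1"
  \<comment> \<open>This keeps the natural-number subtraction in \<open>k\<close> from
    truncating.\<close>
  have "4 * q \<le> q\<^sup>2" using assms(2) by (simp add: power2_eq_square)
  hence k: "0 < k" "k < n" "n = 2 * q - 1 + k" using assms(2,3) by (auto simp: k_def)
  from BCH_subspace[OF assms(1,2,4)] obtain W :: "(nat \<Rightarrow> 'a) set" where W:
    "\<And>v i. v \<in> W \<Longrightarrow> i \<ge> q\<^sup>2 - 1 \<Longrightarrow> v i = 0"
    "\<And>v w. v \<in> W \<Longrightarrow> w \<in> W \<Longrightarrow> (\<lambda>i. v i + w i) \<in> W" "\<And>a v. v \<in> W \<Longrightarrow> (\<lambda>i. a * v i) \<in> W"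
    "\<And>v. v \<in> W \<Longrightarrow> \<exists>i. v i \<noteq> 0 \<Longrightarrow> card {i. v i \<noteq> 0} \<ge> q + 2"
    "q ^ (q\<^sup>2 - 1) \<le> q ^ (2 * q - 1) * card W"
    by blast
  \<comment> \<open>Since n = (2q - 1) + k, cancelling the syndrome count leaves q^k as a lower
    bound for the size of \<open>W\<close>.\<close>
  have "q ^ (2 * q - 1) * q ^ k \<le> q ^ (2 * q - 1) * card W"
    using W(5) k(3) assms(3) by (simp flip: power_add)
  hence card: "card (UNIV :: 'a set) ^ k \<le> card W" using assms(2,4) by simp
  obtain b h where bh: "\<And>i. i < k \<Longrightarrow> b i \<in> W"
    "\<And>i j. i \<le> k \<Longrightarrow> j \<le> k \<Longrightarrow> (\<Sum>l<n. b i l * h j l) = (if i = j then 1 else (0 :: 'a))"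
    using independent_with_dual[of W n k, OF _ card k(2)] W(1) assms(3) by blast
  interpret unit_memory_code n k b h
    by unfold_locales (use k bh(2) in auto)
  have "q + 2 \<le> card {l \<in> {..<n}. (\<Sum>i<k. a i * b i l) \<noteq> 0}" if "\<exists>i<k. a i \<noteq> 0" for a
  proof -
    let ?v = "\<lambda>l. \<Sum>i<k. a i * b i l"
    \<comment> \<open>The zero word, written as a multiple of \<open>b 0\<close>, starts the
      induction showing that \<open>W\<close> contains all combinations of the rows.\<close>
    have "(\<lambda>l. 0 * b 0 l) \<in> W" using W(3) bh(1) k(1) by blast
    hence "(\<lambda>l. \<Sum>i<m. a i * b i l) \<in> W" if "m \<le> k" for m
      using that by (induction m) (auto intro!: W(2,3) bh(1))
    hence v: "?v \<in> W" by simp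
    moreover have "\<exists>l. ?v l \<noteq> 0"
      using nonzero_combination[OF that] by blast
    ultimately have "card {l. ?v l \<noteq> 0} \<ge> q + 2" by (intro W(4))
    moreover have "{l. ?v l \<noteq> 0} = {l \<in> {..<n}. ?v l \<noteq> 0}"
      using W(1)[OF v] assms(3) by (auto simp: not_less[symmetric])
    ultimately show ?thesis by simp
  qed
  hence "free_distance (generated_code G) \<ge> q + 2" by (rule free_distance_ge)
  moreover have "convolutional_code n k 1 1 (free_distance (generated_code G)) (generated_code G)"
    by (rule convolutional_code_G)
  ultimately show ?thesis unfolding k_def by blast
qed

end
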